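(* Let $L>0$ and $\varrho\ge0$. Let $f:\mathbb{R}^n\to\mathbb{R}$ be a $\mathcal{C}^1$-smooth function satisfying the descent condition with constant $L$, let $g:\mathbb{R}^n\to(-\infty,\infty]$ be a proper, lower semicontinuous, $\varrho$-weakly convex function, and let $\varphi:=f+g$. Let $\{x^k\}$, $\{\varepsilon_k\}$, $\{r_k\}$ be sequences generated by the inexact proximal gradient method (described in the context) with parameter $\lambda\in(0,(L+\varrho)^{-1})$, where $\varepsilon_1\le r_1$, $\theta\le\mu$, and the errors $\rho_k\ge0$ satisfy either $$\sum_{k=1}^\infty\rho_k<\infty\qquad\text{or}\qquad \rho_k=C\varepsilon_k^2\ \text{ for all }k\in\mathbb{N},$$ with $$C=\min\Big\{\frac{C_1^2}{4C_2^2},\frac{C_1}{4}\Big\},\quad C_1:=\lambda\big(1-\lambda(L+\varrho)\big),\quad C_2:=2\Big(\sqrt{\tfrac{2}{\lambda^{-1}-\varrho}}+\sqrt{2\lambda}\Big).$$ Assume that $\inf_{k\in\mathbb{N}}\varphi(x^k)>-\infty$. Then: (i) $\varepsilon_k\downarrow0$ and $r_k\downarrow0$ as $k\to\infty$. (ii) Every accumulation point of $\{x^k\}$ is a stationary point of $\varphi$, and $\|x^k-x^{k+1}\|\to0$ as $k\to\infty$. (iii) If the sequence $\{x^k\}$ is bounded, then the set of accumulation points of $\{x^k\}$ is nonempty, compact, and connected. (iv) If $\{x^k\}$ has an isolated accumulation point, then the entire sequence $\{x^k\}$ converges to it.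
   Context: $\mathbb{R}^n$ carries the Euclidean norm; $\mathbb{N}=\{1,2,\ldots\}$; $0^{-1}:=\infty$. Descent condition with constant $L$: $f(x)\le f(y)+\langle\nabla f(y),x-y\rangle+\frac L2\|x-y\|^2$ for all $x,y\in\mathbb{R}^n$. $g$ is $\varrho$-weakly convex if $g(\cdot)+\frac{\varrho}{2}\|\cdot\|^2$ is convex. Stationary point of $\varphi$: $\bar x$ with $0\in\partial\varphi(\bar x)$, where $\partial\varphi$ is the limiting (Mordukhovich) subdifferential; here $\partial\varphi(\bar x)=\nabla f(\bar x)+\partial g(\bar x)$, and for weakly convex $g$ the set $\partial g(\bar x)$ coincides with the regular (Fréchet) subdifferential $\{v:\liminf_{x\to\bar x}\frac{g(x)-g(\bar x)-\langle v,x-\bar x\rangle}{\|x-\bar x\|}\ge0\}$, $\bar x\in\operatorname{dom} g$. Notation: $F_\lambda(x):=x-\lambda\nabla f(x)$ and $\Phi_{\lambda,z}(y):=g(y)+\frac{1}{2\lambda}\|y-z\|^2$. Inexact proximal gradient method. Parameters: $\lambda\in(0,(L+\varrho)^{-1})$, $x^1\in\mathbb{R}^n$, $\varepsilon_1,r_1>0$, $\mu,\theta\in(0,1)$, and a sequence $\{\rho_k\}\subset[0,\infty)$ (which may depend on $\varepsilon_k$). For each $k\in\mathbb{N}$: - choose any $p^k\in\mathbb{R}^n$ with $\Phi_{\lambda,F_\lambda(x^k)}(p^k)\le\inf_{y\in\mathbb{R}^n}\Phi_{\lambda,F_\lambda(x^k)}(y)+\min\big\{\tfrac{\lambda(1-\lambda\varrho)\varepsilon_k^2}{2},\rho_k\big\}$,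 and put $g^k:=\lambda^{-1}(x^k-p^k)$; - if $\|g^k\|\le r_k+\varepsilon_k$, set $r_{k+1}:=\mu r_k$, $\varepsilon_{k+1}:=\theta\varepsilon_k$, $x^{k+1}:=x^k$; otherwise set $r_{k+1}:=r_k$, $\varepsilon_{k+1}:=\varepsilon_k$, $x^{k+1}:=p^k$. *)

theory Defs
  imports "HOL-Analysis.Analysis"
begin

section \<open>Extended-real-valued functions\<close>

text \<open>Functions with values in the half-open interval from minus infinity (excluded) to plus
  infinity (included) are modelled as \<open>ereal\<close>-valued functions; the exclusion of \<open>-\<infinity>\<close>
  is part of \<open>proper_fun\<close>.\<close>

definition proper_fun :: "('a \<Rightarrow> ereal) \<Rightarrow> bool" where
  "proper_fun g \<longleftrightarrow> (\<forall>x. g x \<noteq> -\<infinity>) \<and> (\<exists>x. g x \<noteq> \<infinity>)"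

definition lsc_fun :: "('a::topological_space \<Rightarrow> ereal) \<Rightarrow> bool" where
  "lsc_fun g \<longleftrightarrow> (\<forall>x. g x \<le> Liminf (at x) g)"

text \<open>Meaningful only for functions that never take the value \<open>-\<infinity>\<close>; otherwise the right-hand
  side may contain the sum of \<open>\<infinity>\<close> and \<open>-\<infinity>\<close>.\<close>

definition convex_fun :: "('a::real_vector \<Rightarrow> ereal) \<Rightarrow> bool" where
  "convex_fun g \<longleftrightarrow>
     (\<forall>x y. \<forall>t\<in>{0<..<1::real}.
        g ((1 - t) *\<^sub>R x + t *\<^sub>R y) \<le> ereal (1 - t) * g x + ereal t * g y)"

definition weakly_convex :: "real \<Rightarrow> ('a::real_normed_vector \<Rightarrow> ereal) \<Rightarrow> bool" where
  "weakly_convex \<rho> g \<longleftrightarrow> convex_fun (\<lambda>x. g x + ereal (\<rho> / 2 * (norm x)\<^sup>2))"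


section \<open>Subdifferentials and stationary points\<close>

definition regular_subdifferential :: "('a::real_inner \<Rightarrow> ereal) \<Rightarrow> 'a \<Rightarrow> 'a set" where
  "regular_subdifferential \<phi> u =
     {v. \<bar>\<phi> u\<bar> \<noteq> \<infinity> \<and>
         0 \<le> Liminf (at u) (\<lambda>x. (\<phi> x - \<phi> u - ereal (v \<bullet> (x - u))) / ereal (norm (x - u)))}"

definition limiting_subdifferential :: "('a::real_inner \<Rightarrow> ereal) \<Rightarrow> 'a \<Rightarrow> 'a set" where
  "limiting_subdifferential \<phi> u =
     {v. \<bar>\<phi> u\<bar> \<noteq> \<infinity> \<and>
         (\<exists>y w. y \<longlonglongrightarrow> u \<and> (\<lambda>k. \<phi> (y k)) \<longlonglongrightarrow> \<phi> u \<and>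
                (\<forall>k. w k \<in> regular_subdifferential \<phi> (y k)) \<and> w \<longlonglongrightarrow> v)}"

definition stationary_point :: "('a::real_inner \<Rightarrow> ereal) \<Rightarrow> 'a \<Rightarrow> bool" where
  "stationary_point \<phi> u \<longleftrightarrow> 0 \<in> limiting_subdifferential \<phi> u"


section \<open>Accumulation points of sequences\<close>

definition accumulation_points :: "(nat \<Rightarrow> 'a::topological_space) \<Rightarrow> 'a set" where
  "accumulation_points x = {l. \<exists>s. strict_mono s \<and> (x \<circ> s) \<longlonglongrightarrow> l}"


section \<open>The smooth part\<close>

definition C1_with_gradient :: "('a::real_inner \<Rightarrow> real) \<Rightarrow> ('a \<Rightarrow> 'a) \<Rightarrow> bool" where
  "C1_with_gradient f df \<longleftrightarrow> (\<forall>x. GDERIV f x :> df x) \<and> continuous_on UNIV df"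

definition descent_condition ::
  "real \<Rightarrow> ('a::real_inner \<Rightarrow> real) \<Rightarrow> ('a \<Rightarrow> 'a) \<Rightarrow> bool" where
  "descent_condition L f df \<longleftrightarrow>
     (\<forall>x y. f x \<le> f y + df y \<bullet> (x - y) + L / 2 * (norm (x - y))\<^sup>2)"


section \<open>The inexact proximal gradient method\<close>

definition forward_step :: "real \<Rightarrow> ('a::real_vector \<Rightarrow> 'a) \<Rightarrow> 'a \<Rightarrow> 'a" where
  "forward_step lam df x = x - lam *\<^sub>R df x"

definition prox_objective ::
  "('a::real_normed_vector \<Rightarrow> ereal) \<Rightarrow> real \<Rightarrow> 'a \<Rightarrow> 'a \<Rightarrow> ereal" where
  "prox_objective g lam z y = g y + ereal (1 / (2 * lam) * (norm (y - z))\<^sup>2)"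

text \<open>Iterations are numbered from 1; the values of the sequences at 0 are unconstrained and
  irrelevant. Here \<open>\<rho>\<close> is the weak convexity modulus and \<open>err\<close> is the sequence of errors.
  The points \<open>p k\<close> are the inexact proximal points, and the generalized gradient of iteration
  \<open>k\<close> is written out as \<open>(1 / lam) *\<^sub>R (x k - p k)\<close>.\<close>

definition inexact_prox_grad ::
  "('a::real_normed_vector \<Rightarrow> 'a) \<Rightarrow> ('a \<Rightarrow> ereal) \<Rightarrow> real \<Rightarrow> real \<Rightarrow> real \<Rightarrow> real \<Rightarrow>
   (nat \<Rightarrow> real) \<Rightarrow> (nat \<Rightarrow> 'a) \<Rightarrow> (nat \<Rightarrow> 'a) \<Rightarrow> (nat \<Rightarrow> real) \<Rightarrow> (nat \<Rightarrow> real) \<Rightarrow> bool" where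
  "inexact_prox_grad df g \<rho> lam \<mu> \<theta> err x p \<epsilon> r \<longleftrightarrow>
     (\<forall>k\<ge>1.
        prox_objective g lam (forward_step lam df (x k)) (p k)
          \<le> (INF y. prox_objective g lam (forward_step lam df (x k)) y)
             + ereal (min (lam * (1 - lam * \<rho>) * (\<epsilon> k)\<^sup>2 / 2) (err k)) \<and>
        (if norm ((1 / lam) *\<^sub>R (x k - p k)) \<le> r k + \<epsilon> k
         then r (Suc k) = \<mu> * r k \<and> \<epsilon> (Suc k) = \<theta> * \<epsilon> k \<and> x (Suc k) = x k
         else r (Suc k) = r k \<and> \<epsilon> (Suc k) = \<epsilon> k \<and> x (Suc k) = p k))"

end

(* Write \<Phi>_k for the k-th proximal objective. It is strongly convex, so it has a minimizer q_k, and the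
   inexact minimizer p_k satisfies |p_k - q_k| <= 2 lam \<epsilon>_k. Combining the descent condition with
   \<Phi>_k(p_k) <= \<Phi>_k(x_k) + err_k gives \<phi>(x_{k+1}) + a |x_{k+1} - x_k|^2 <= \<phi>(x_k) + e_k for some
   a > 0 and a summable e; hence the steps tend to 0. A non-null step is longer than lam (r_k + \<epsilon>_k),
   so null steps occur infinitely often and r_k, \<epsilon>_k tend to 0. Therefore x_k - p_k and x_k - q_k tend
   to 0, and passing to the limit in the optimality condition of q_k shows that accumulation points
   are stationary. The structure of the set of accumulation points is Ostrowski's theorem on sequences
   whose steps tend to 0. *)

theory Submission
  imports Defs
begin

section \<open>Lower semicontinuity along convergent sequences\<close>

lemma lsc_fun_eventually_less:
  fixes g :: "'a::topological_space \<Rightarrow> ereal"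
  assumes "lsc_fun g" "(y \<longlongrightarrow> u) F" "c < g u"
  shows "\<forall>\<^sub>F k in F. c < g (y k)"
proof -
  from assms(1) have "g u \<le> Liminf (at u) g" by (simp add: lsc_fun_def)
  \<comment> \<open>The filter \<open>at u\<close> says nothing about \<open>u\<close> itself;
    \<open>c < g u\<close> fills in that point, so that \<open>y\<close> is allowed to hit
    \<open>u\<close>.\<close>
  with assms(3) have "\<forall>\<^sub>F w in at u. c < g w"
    unfolding le_Liminf_iff by blast
  with assms(3) have "\<forall>\<^sub>F w in nhds u. c < g w"
    by (simp add: eventually_nhds_conv_at)
  then show ?thesis
    using assms(2) by (rule eventually_compose_filterlim)
qed

lemma lsc_fun_tendsto_le:
  fixes g :: "'a::topological_space \<Rightarrow> ereal"
  assumes "lsc_fun g" "y \<longlonglongrightarrow> u" "\<And>k. g (y k) \<le> ereal (c k)" "c \<longlonglongrightarrow> c0"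
  shows "g u \<le> ereal c0"
proof (rule ccontr)
  assume "\<not> g u \<le> ereal c0"
  then have "ereal c0 < g u" by simp
  then obtain d where d: "ereal c0 < ereal d" "ereal d < g u"
    using ereal_dense2 by blast
  have "\<forall>\<^sub>F k in sequentially. ereal d < g (y k)"
    by (rule lsc_fun_eventually_less[OF assms(1,2) d(2)])
  then have "\<forall>\<^sub>F k in sequentially. d \<le> c k"
  proof eventually_elim
    case (elim k)
    then have "ereal d < ereal (c k)" using assms(3)[of k] by (rule less_le_trans)
    then show ?case by simp
  qed
  then have "d \<le> c0"
    using assms(4) by (intro tendsto_lowerbound) auto
  with d show False by simp
qed

section \<open>Strong convexity and minimizers of the proximal objective\<close>

text \<open>The parallelogram identity. Its last term is the source of every strong convexity
  constant below.\<close>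

lemma norm_sq_midpoint:
  fixes a b :: "'a::real_inner"
  shows "(norm (midpoint a b))\<^sup>2 = ((norm a)\<^sup>2 + (norm b)\<^sup>2) / 2 - (norm (a - b))\<^sup>2 / 4"
  unfolding midpoint_def scaleR_add_right power2_norm_eq_inner
  by (simp only: inner_add_left inner_add_right inner_diff_left inner_diff_right
      inner_scaleR_left inner_scaleR_right) (simp add: inner_commute field_simps)

text \<open>Convexity of the shifted function is used with weight 1/2 only; removing the quadratic
  shift by the parallelogram identity leaves the defect \<open>\<rho> / 8\<close>. The finite upper
  bound also makes \<open>g\<close> real at the midpoint.\<close>

lemma weakly_convex_midpoint:
  fixes g :: "'a::real_inner \<Rightarrow> ereal"
  assumes "weakly_convex \<rho> g" "proper_fun g" "g a = ereal \<alpha>" "g b = ereal \<beta>"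
  obtains \<gamma> where "g (midpoint a b) = ereal \<gamma>" "\<gamma> \<le> (\<alpha> + \<beta>) / 2 + \<rho> / 8 * (norm (a - b))\<^sup>2"
proof -
  define m where "m = midpoint a b"
  have "g ((1 - 1/2) *\<^sub>R a + (1/2) *\<^sub>R b) + ereal (\<rho> / 2 * (norm ((1 - 1/2) *\<^sub>R a + (1/2::real) *\<^sub>R b))\<^sup>2)
      \<le> ereal (1 - 1/2) * (g a + ereal (\<rho> / 2 * (norm a)\<^sup>2))
        + ereal (1/2) * (g b + ereal (\<rho> / 2 * (norm b)\<^sup>2))"
    using assms(1) unfolding weakly_convex_def convex_fun_def
    by (elim allE[of _ a] allE[of _ b] ballE[of _ _ "1/2::real"]) auto
  moreover have "(1 - 1/2) *\<^sub>R a + (1/2::real) *\<^sub>R b = m"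
    by (simp add: m_def midpoint_def scaleR_add_right)
  ultimately have *: "g m + ereal (\<rho> / 2 * (norm m)\<^sup>2)
      \<le> ereal ((\<alpha> + \<rho> / 2 * (norm a)\<^sup>2) / 2 + (\<beta> + \<rho> / 2 * (norm b)\<^sup>2) / 2)"
    using assms(3,4) by (simp add: field_simps)
  moreover have "g m \<noteq> -\<infinity>" using assms(2) by (simp add: proper_fun_def)
  ultimately obtain \<gamma> where \<gamma>: "g m = ereal \<gamma>" by (cases "g m") auto
  with * have "\<gamma> \<le> (\<alpha> + \<beta>) / 2 + \<rho> / 8 * (norm (a - b))\<^sup>2"
    unfolding m_def norm_sq_midpoint by (simp add: field_simps)
  with \<gamma> that show thesis by (simp add: m_def)
qed

lemma prox_objective_eq_ereal_iff:
  "prox_objective g lam z y = ereal A \<longleftrightarrow> g y = ereal (A - 1 / (2 * lam) * (norm (y - z))\<^sup>2)"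
  by (cases "g y") (auto simp: prox_objective_def)

text \<open>At the midpoint of \<open>a\<close> and \<open>b\<close> the quadratic term gains
  \<open>1 / (8 * lam)\<close> times the squared distance, while weak convexity costs at most
  \<open>\<rho> / 8\<close> times it. As the value there is still at least \<open>m\<close>, the net
  gain is at most \<open>(s + t) / 2\<close>.\<close>

lemma prox_objective_near_minimizers:
  fixes g :: "'a::real_inner \<Rightarrow> ereal"
  assumes wc: "weakly_convex \<rho> g" and pr: "proper_fun g"
    and lower: "\<And>y. ereal m \<le> prox_objective g lam z y"
    and a: "prox_objective g lam z a \<le> ereal (m + s)"
    and b: "prox_objective g lam z b \<le> ereal (m + t)"
  shows "(1 / lam - \<rho>) / 4 * (norm (a - b))\<^sup>2 \<le> s + t"
proof -
  obtain A where A: "prox_objective g lam z a = ereal A" "A \<le> m + s"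
    using a lower[of a] by (cases "prox_objective g lam z a") auto
  obtain B where B: "prox_objective g lam z b = ereal B" "B \<le> m + t"
    using b lower[of b] by (cases "prox_objective g lam z b") auto
  obtain \<gamma> where \<gamma>: "g (midpoint a b) = ereal \<gamma>"
    "\<gamma> \<le> ((A - 1 / (2 * lam) * (norm (a - z))\<^sup>2) + (B - 1 / (2 * lam) * (norm (b - z))\<^sup>2)) / 2
         + \<rho> / 8 * (norm (a - b))\<^sup>2"
    using weakly_convex_midpoint[OF wc pr] A(1) B(1) unfolding prox_objective_eq_ereal_iff by metis
  have "midpoint a b - z = midpoint (a - z) (b - z)"
    by (simp add: midpoint_def algebra_simps scaleR_2[symmetric] flip: scaleR_add_left)
  then have n: "(norm (midpoint a b - z))\<^sup>2
      = ((norm (a - z))\<^sup>2 + (norm (b - z))\<^sup>2) / 2 - (norm (a - b))\<^sup>2 / 4"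
    using norm_sq_midpoint[of "a - z" "b - z"] by simp
  have "m \<le> \<gamma> + 1 / (2 * lam) * (norm (midpoint a b - z))\<^sup>2"
    using lower[of "midpoint a b"] \<gamma>(1) by (simp add: prox_objective_def)
  also have "\<dots> \<le> (A + B) / 2 - (1 / lam - \<rho>) / 8 * (norm (a - b))\<^sup>2"
    using \<gamma>(2) unfolding n by (simp add: algebra_simps add_divide_distrib diff_divide_distrib)
  finally show ?thesis using A(2) B(2) by (simp add: field_simps)
qed

text \<open>No coercivity argument is needed: the inexact minimizer \<open>p\<close> already forces the infimum to be
  finite, and strong convexity makes every minimizing sequence Cauchy.\<close>

lemma prox_objective_minimizer:
  fixes g :: "'a::{real_inner,complete_space} \<Rightarrow> ereal"
  assumes wc: "weakly_convex \<rho> g" and pr: "proper_fun g" and lsc: "lsc_fun g"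
    and sigma: "\<rho> < 1 / lam"
    and p: "prox_objective g lam z p \<le> (INF y. prox_objective g lam z y) + ereal d"
  obtains q where "\<And>y. prox_objective g lam z q \<le> prox_objective g lam z y"
    "(1 / lam - \<rho>) / 4 * (norm (p - q))\<^sup>2 \<le> d"
proof -
  define h where "h = prox_objective g lam z"
  define \<sigma> where "\<sigma> = (1 / lam - \<rho>) / 4"
  have \<sigma>: "\<sigma> > 0" using sigma by (simp add: \<sigma>_def)
  have "h p \<noteq> -\<infinity>" using pr by (cases "g p") (auto simp: h_def prox_objective_def proper_fun_def)
  then have 1: "(INF y. h y) \<noteq> -\<infinity>" using p by (auto simp: h_def)
  obtain w where "g w \<noteq> \<infinity>" using pr by (auto simp: proper_fun_def)
  then have "h w \<noteq> \<infinity>" by (auto simp: h_def prox_objective_def)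
  then have 2: "(INF y. h y) \<noteq> \<infinity>" by (metis INF_lower UNIV_I ereal_infty_less_eq(1))
  obtain m where m: "(INF y. h y) = ereal m" using 1 2 by (cases "INF y. h y") auto
  have lower: "ereal m \<le> h y" for y by (metis m INF_lower UNIV_I)
  have "\<exists>y. h y \<le> ereal (m + inverse (real (Suc k)))" for k
  proof -
    have "(INF y. h y) < ereal (m + inverse (real (Suc k)))" unfolding m by simp
    then show ?thesis unfolding INF_less_iff by (auto intro: less_imp_le)
  qed
  then obtain y where y: "\<And>k. h (y k) \<le> ereal (m + inverse (real (Suc k)))" by metis
  have near: "\<sigma> * (norm (a - b))\<^sup>2 \<le> s + t"
    if "h a \<le> ereal (m + s)" "h b \<le> ereal (m + t)" for a b s t
    using prox_objective_near_minimizers[OF wc pr lower[unfolded h_def]] that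
    unfolding h_def \<sigma>_def by blast
  have "Cauchy y"
  proof (rule metric_CauchyI)
    fix e :: real assume "e > 0"
    with \<sigma> have "\<sigma> * e\<^sup>2 / 2 > 0" by simp
    then obtain N where N: "inverse (real (Suc N)) < \<sigma> * e\<^sup>2 / 2"
      using reals_Archimedean by blast
    have "dist (y i) (y j) < e" if "i \<ge> N" "j \<ge> N" for i j
    proof -
      have "inverse (real (Suc i)) \<le> inverse (real (Suc N))"
        "inverse (real (Suc j)) \<le> inverse (real (Suc N))"
        using that by (simp_all add: field_simps)
      then have "\<sigma> * (norm (y i - y j))\<^sup>2 < \<sigma> * e\<^sup>2"
        using near[OF y[of i] y[of j]] N by linarith
      with \<sigma> have "(norm (y i - y j))\<^sup>2 < e\<^sup>2" by simp
      with \<open>e > 0\<close> show ?thesis by (simp add: dist_norm power2_less_imp_less)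
    qed
    then show "\<exists>N. \<forall>i\<ge>N. \<forall>j\<ge>N. dist (y i) (y j) < e" by blast
  qed
  then obtain q where q: "y \<longlonglongrightarrow> q" using Cauchy_convergent convergent_def by blast
  \<comment> \<open>Semicontinuity is assumed of \<open>g\<close> alone, so the quadratic term is
    moved into the upper bound, where it converges by continuity.\<close>
  have "g q \<le> ereal (m + 0 - 1 / (2 * lam) * (norm (q - z))\<^sup>2)"
  proof (rule lsc_fun_tendsto_le[OF lsc q])
    show "g (y k) \<le> ereal (m + inverse (real (Suc k)) - 1 / (2 * lam) * (norm (y k - z))\<^sup>2)" for k
      using y[of k] by (cases "g (y k)") (auto simp: h_def prox_objective_def)
    show "(\<lambda>k. m + inverse (real (Suc k)) - 1 / (2 * lam) * (norm (y k - z))\<^sup>2)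
        \<longlonglongrightarrow> m + 0 - 1 / (2 * lam) * (norm (q - z))\<^sup>2"
      by (intro tendsto_intros q LIMSEQ_inverse_real_of_nat)
  qed
  then have hq: "h q \<le> ereal m"
    by (cases "g q") (auto simp: h_def prox_objective_def)
  show thesis
  proof
    show "prox_objective g lam z q \<le> prox_objective g lam z y" for y
      using order_trans[OF hq lower] by (simp add: h_def)
    have "h p \<le> ereal (m + d)" using p m by (simp add: h_def)
    from near[OF this, of q 0] hq show "(1 / lam - \<rho>) / 4 * (norm (p - q))\<^sup>2 \<le> d"
      by (simp add: \<sigma>_def)
  qed
qed

section \<open>One proximal gradient step: descent and subgradients\<close>

text \<open>Expanding the square shows the objective as \<open>g\<close> plus the linear part of
  \<open>f\<close> at \<open>u\<close> plus a proximal term centred at \<open>u\<close>. The last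
  summand does not depend on \<open>y\<close> and cancels whenever two values are compared.\<close>

lemma prox_objective_forward_step:
  fixes g :: "'a::real_inner \<Rightarrow> ereal"
  assumes "lam > 0"
  shows "prox_objective g lam (forward_step lam df u) y =
    g y + ereal ((norm (y - u))\<^sup>2 / (2 * lam) + df u \<bullet> (y - u) + lam / 2 * (norm (df u))\<^sup>2)"
proof -
  have "y - forward_step lam df u = (y - u) + lam *\<^sub>R df u" by (simp add: forward_step_def)
  then have "(norm (y - forward_step lam df u))\<^sup>2
      = (norm (y - u))\<^sup>2 + 2 * lam * (df u \<bullet> (y - u)) + lam\<^sup>2 * (norm (df u))\<^sup>2"
    unfolding power2_norm_eq_inner
    by (simp only: inner_add_left inner_add_right inner_scaleR_left inner_scaleR_right)
      (simp add: inner_commute power2_eq_square algebra_simps)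
  with assms show ?thesis
    by (simp add: prox_objective_def field_simps power2_eq_square)
qed

text \<open>At \<open>y = u\<close> only the constant of the expanded square is left, so the
  hypothesis bounds \<open>g p\<close> plus the linear and proximal terms by \<open>g u + d\<close>;
  adding the descent condition removes the linear term. Keeping sums on both sides admits infinite
  \<open>g u\<close>.\<close>

lemma inexact_prox_grad_descent:
  fixes g :: "'a::real_inner \<Rightarrow> ereal"
  assumes dc: "descent_condition L f df" and lam: "lam > 0"
    and p: "prox_objective g lam (forward_step lam df u) p
             \<le> prox_objective g lam (forward_step lam df u) u + ereal d"
  shows "ereal (f p) + g p + ereal ((1 / lam - L) / 2 * (norm (p - u))\<^sup>2)
           \<le> ereal (f u) + g u + ereal d"
proof -
  have "f p \<le> f u + df u \<bullet> (p - u) + L / 2 * (norm (p - u))\<^sup>2"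
    using dc by (simp add: descent_condition_def)
  then show ?thesis
    using p unfolding prox_objective_forward_step[OF lam]
    by (cases "g p"; cases "g u") (auto simp: field_simps)
qed

text \<open>The hypothesis on \<open>g\<close> is a quadratic minorant touching at \<open>u\<close>,
  which is the form in which minimality in the proximal problem delivers subgradients. Dividing by
  the distance to \<open>u\<close> turns its quadratic term into one that vanishes at
  \<open>u\<close>, as does the remainder quotient of \<open>f\<close>.\<close>

lemma regular_subdifferential_add_smooth:
  fixes g :: "'a::{real_inner,perfect_space} \<Rightarrow> ereal"
  assumes gu: "g u = ereal \<gamma>"
    and minor: "\<And>y. g y \<ge> ereal (\<gamma> + v \<bullet> (y - u) - c * (norm (y - u))\<^sup>2)"
    and f: "GDERIV f u :> d"
  shows "d + v \<in> regular_subdifferential (\<lambda>y. ereal (f y) + g y) u"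
proof -
  define R where "R = (\<lambda>y. (f y - f u - d \<bullet> (y - u)) / norm (y - u) - c * norm (y - u))"
  have 1: "((\<lambda>y. (f y - f u - d \<bullet> (y - u)) / norm (y - u)) \<longlongrightarrow> 0) (at u)"
    using f by (simp add: gderiv_def has_derivative_within inner_commute diff_diff_eq)
  have 2: "((\<lambda>y. c * norm (y - u)) \<longlongrightarrow> c * norm (u - u)) (at u)"
    by (intro tendsto_intros)
  have "(R \<longlongrightarrow> 0) (at u)"
    using tendsto_diff[OF 1 2] by (simp add: R_def)
  \<comment> \<open>The sort \<open>perfect_space\<close> keeps \<open>at u\<close> from being
    trivial, so the limit inferior is the limit.\<close>
  then have "Liminf (at u) (\<lambda>y. ereal (R y)) = ereal 0"
    by (intro lim_imp_Liminf) auto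
  moreover have "Liminf (at u) (\<lambda>y. ereal (R y)) \<le> Liminf (at u)
      (\<lambda>y. (ereal (f y) + g y - (ereal (f u) + g u) - ereal ((d + v) \<bullet> (y - u))) / ereal (norm (y - u)))"
  proof (rule Liminf_mono)
    show "\<forall>\<^sub>F y in at u. ereal (R y) \<le>
      (ereal (f y) + g y - (ereal (f u) + g u) - ereal ((d + v) \<bullet> (y - u))) / ereal (norm (y - u))"
      unfolding eventually_at_filter
    proof (intro always_eventually allI impI)
      fix y assume "y \<noteq> u"
      then have n: "norm (y - u) > 0" by simp
      show "ereal (R y) \<le>
        (ereal (f y) + g y - (ereal (f u) + g u) - ereal ((d + v) \<bullet> (y - u))) / ereal (norm (y - u))"
      proof (cases "g y")
        case (real \<beta>)
        have "R y * norm (y - u) \<le> f y + \<beta> - (f u + \<gamma>) - (d + v) \<bullet> (y - u)"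
          using minor[of y] n unfolding real R_def left_diff_distrib
          by (simp add: inner_add_left power2_eq_square)
        then show ?thesis using n real gu by (simp add: pos_le_divide_eq)
      next
        case PInf
        then show ?thesis using n gu by (simp add: PInfty_neq_ereal)
      next
        case MInf
        then show ?thesis using minor[of y] by simp
      qed
    qed
  qed
  ultimately show ?thesis
    using gu by (auto simp: regular_subdifferential_def zero_ereal_def)
qed

text \<open>Expanding the proximal term around \<open>q\<close> instead of \<open>u\<close>,
  minimality says that \<open>g\<close> lies above a quadratic through its value at
  \<open>q\<close>, with slope \<open>(1 / lam) *\<^sub>R (u - q) - df u\<close> and leading
  coefficient \<open>- 1 / (2 * lam)\<close>.\<close>

lemma prox_objective_minimizer_subgradient:
  fixes g :: "'a::{real_inner,perfect_space} \<Rightarrow> ereal"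
  assumes lam: "lam > 0" and pr: "proper_fun g"
    and min: "\<And>y. prox_objective g lam (forward_step lam df u) q
                  \<le> prox_objective g lam (forward_step lam df u) y"
    and f: "GDERIV f q :> df q"
  shows "df q + ((1 / lam) *\<^sub>R (u - q) - df u) \<in> regular_subdifferential (\<lambda>y. ereal (f y) + g y) q"
proof -
  obtain w where "g w \<noteq> \<infinity>" using pr by (auto simp: proper_fun_def)
  then have "g q \<noteq> \<infinity>" using min[of w] by (auto simp: prox_objective_def)
  moreover have "g q \<noteq> -\<infinity>" using pr by (auto simp: proper_fun_def)
  ultimately obtain \<gamma> where \<gamma>: "g q = ereal \<gamma>" by (cases "g q") auto
  show ?thesis
  proof (rule regular_subdifferential_add_smooth[where g = g and f = f, OF \<gamma> _ f])
    fix y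
    have "y - u = (y - q) - (u - q)" by simp
    then have "(norm (y - u))\<^sup>2 = (norm (y - q))\<^sup>2 - 2 * ((u - q) \<bullet> (y - q)) + (norm (q - u))\<^sup>2"
      unfolding power2_norm_eq_inner
      by (simp only: inner_diff_left inner_diff_right inner_commute) (simp add: algebra_simps inner_commute)
    moreover have "df u \<bullet> (y - u) = df u \<bullet> (y - q) + df u \<bullet> (q - u)" by (simp add: inner_diff_right)
    ultimately show "ereal (\<gamma> + ((1 / lam) *\<^sub>R (u - q) - df u) \<bullet> (y - q) - 1 / (2 * lam) * (norm (y - q))\<^sup>2) \<le> g y"
      using min[of y] \<gamma> lam unfolding prox_objective_forward_step[OF lam]
      by (cases "g y") (auto simp: inner_diff_left add_divide_distrib diff_divide_distrib)
  qed
qed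

section \<open>Accumulation points of sequences whose steps tend to zero\<close>

text \<open>This lemma and the next one translate between accumulation points and frequent visits,
  so that the crossing arguments below involve no explicit subsequences.\<close>

lemma frequently_accumulation_pointI:
  fixes x :: "nat \<Rightarrow> 'a::heine_borel"
  assumes "compact K" "\<exists>\<^sub>F k in sequentially. x k \<in> K"
  obtains l where "l \<in> K" "l \<in> accumulation_points x"
proof -
  have "infinite {k. x k \<in> K}"
    using assms(2) by (simp add: frequently_cofinite flip: cofinite_eq_sequentially)
  then obtain s :: "nat \<Rightarrow> nat" where s: "strict_mono s" "\<And>n. x (s n) \<in> K"
    using infinite_enumerate by blast
  then obtain l t where "l \<in> K" "strict_mono t" "((x \<circ> s) \<circ> t) \<longlonglongrightarrow> l"
    using assms(1) unfolding compact_def by (metis comp_apply)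
  moreover from this have "strict_mono (s \<circ> t)" "(x \<circ> (s \<circ> t)) \<longlonglongrightarrow> l"
    using s(1) by (simp_all add: strict_mono_o comp_assoc)
  ultimately show thesis
    using that unfolding accumulation_points_def by blast
qed

lemma accumulation_point_frequently:
  assumes "l \<in> accumulation_points x" "open S" "l \<in> S"
  shows "\<exists>\<^sub>F k in sequentially. x k \<in> S"
proof -
  obtain s where s: "strict_mono s" "(x \<circ> s) \<longlonglongrightarrow> l"
    using assms(1) by (auto simp: accumulation_points_def)
  have "\<forall>\<^sub>F n in sequentially. x (s n) \<in> S"
    using topological_tendstoD[OF s(2) assms(2,3)] by simp
  then have "\<exists>\<^sub>F n in sequentially. x (s n) \<in> S"
    by (rule eventually_frequently[rotated]) simp
  moreover have "filterlim s sequentially sequentially" by (rule filterlim_subseq[OF s(1)])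
  ultimately show ?thesis
    unfolding frequently_def by (auto dest: eventually_compose_filterlim)
qed

lemma closed_accumulation_points:
  fixes x :: "nat \<Rightarrow> 'a::heine_borel"
  shows "closed (accumulation_points x)"
proof -
  have "l \<in> accumulation_points x" if "l \<in> closure (accumulation_points x)" for l
  proof -
    have fr: "\<exists>\<^sub>F k in sequentially. dist (x k) l < e" if "e > 0" for e
    proof -
      obtain y where y: "y \<in> accumulation_points x" "dist y l < e"
        using \<open>l \<in> closure _\<close> \<open>e > 0\<close> by (auto simp: closure_approachable)
      then show ?thesis
        using accumulation_point_frequently[of y x "ball l e"] by (auto simp: dist_commute)
    qed
    have "\<forall>n N. \<exists>k. k > N \<and> dist (x k) l < inverse (real (Suc n))"
    proof (intro allI)
      fix n N
      have "\<exists>\<^sub>F k in sequentially. dist (x k) l < inverse (real (Suc n))" by (rule fr) simp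
      then obtain k where "k \<ge> Suc N" "dist (x k) l < inverse (real (Suc n))"
        unfolding frequently_sequentially by blast
      then show "\<exists>k. k > N \<and> dist (x k) l < inverse (real (Suc n))" by (auto simp: Suc_le_eq)
    qed
    then obtain F where "\<forall>n N. F n N > N \<and> dist (x (F n N)) l < inverse (real (Suc n))"
      unfolding choice_iff by blast
    then have F: "F n N > N" "dist (x (F n N)) l < inverse (real (Suc n))" for n N by blast+
    define s where "s = rec_nat (F 0 0) (\<lambda>n i. F (Suc n) i)"
    have s: "s 0 = F 0 0" "\<And>n. s (Suc n) = F (Suc n) (s n)" by (simp_all add: s_def)
    have "strict_mono s" by (rule strict_mono_Suc_iff[THEN iffD2]) (simp add: s F)
    moreover have "dist ((x \<circ> s) n) l < inverse (real (Suc n))" for n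
      by (cases n) (simp_all only: comp_apply s F)
    then have "(\<lambda>n. dist ((x \<circ> s) n) l) \<longlonglongrightarrow> 0"
      by (intro tendsto_sandwich[OF _ _ tendsto_const LIMSEQ_inverse_real_of_nat])
        (auto intro: always_eventually less_imp_le)
    then have "(x \<circ> s) \<longlonglongrightarrow> l" by (rule tendsto_dist_iff[THEN iffD2])
    ultimately show ?thesis by (auto simp: accumulation_points_def)
  qed
  then show ?thesis unfolding closure_subset_eq[symmetric] by (rule subsetI)
qed

text \<open>A sequence whose steps tend to zero cannot jump over the gap \<open>(a, b)\<close> infinitely often.\<close>

lemma frequently_crossing:
  fixes u :: "nat \<Rightarrow> real"
  assumes step: "(\<lambda>k. u (Suc k) - u k) \<longlonglongrightarrow> 0" and "a < b"
    and lo: "\<exists>\<^sub>F k in sequentially. u k \<le> a" and hi: "\<exists>\<^sub>F k in sequentially. b \<le> u k"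
  shows "\<exists>\<^sub>F k in sequentially. a < u k \<and> u k < b"
  unfolding frequently_sequentially
proof
  fix N
  \<comment> \<open>From \<open>M\<close> on a single step is shorter than the gap is wide.\<close>
  obtain M where M: "\<And>k. k \<ge> M \<Longrightarrow> \<bar>u (Suc k) - u k\<bar> < b - a"
    using LIMSEQ_D[OF step, of "b - a"] \<open>a < b\<close> by auto
  obtain i where i: "i \<ge> max M N" "u i \<le> a" using lo unfolding frequently_sequentially by blast
  obtain j where j: "j \<ge> i" "b \<le> u j" using hi unfolding frequently_sequentially by blast
  show "\<exists>n\<ge>N. a < u n \<and> u n < b"
  proof (rule ccontr)
    assume no: "\<not> ?thesis"
    \<comment> \<open>Without a visit to the gap, a value at most \<open>a\<close> is followed by
      another such value; this excludes the later value \<open>u j\<close>.\<close>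
    have "u n \<le> a" if "n \<ge> i" for n
      using that
    proof (induction n rule: dec_induct)
      case base
      show ?case by (rule i)
    next
      case (step n)
      then have "u (Suc n) < b" using M[of n] i(1) by auto
      with no i(1) step show ?case by (metis Suc_leD le_Suc_eq leI max.bounded_iff order_trans)
    qed
    with j \<open>a < b\<close> show False by fastforce
  qed
qed

text \<open>The function \<open>h\<close> will be the distance to a point or to a set. Being
  1-Lipschitz it inherits vanishing steps, so the sequence visits the strip between \<open>a\<close>
  and \<open>b\<close> infinitely often, and compactness provides an accumulation point there. The
  set \<open>K\<close> is asked to catch only iterates with \<open>h\<close> below \<open>b\<close>,
  so that a ball can serve when the sequence is not known to be bounded.\<close>

lemma lipschitz_crossing_accumulation_point:
  fixes x :: "nat \<Rightarrow> 'a::{real_normed_vector,heine_borel}" and h :: "'a \<Rightarrow> real"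
  assumes step: "(\<lambda>k. norm (x k - x (Suc k))) \<longlonglongrightarrow> 0"
    and lip: "\<And>y z. \<bar>h y - h z\<bar> \<le> dist y z" and "a < b"
    and lo: "\<exists>\<^sub>F k in sequentially. h (x k) \<le> a" and hi: "\<exists>\<^sub>F k in sequentially. b \<le> h (x k)"
    and K: "compact K" "\<And>k. k \<ge> 1 \<Longrightarrow> h (x k) < b \<Longrightarrow> x k \<in> K"
  obtains l where "l \<in> accumulation_points x" "a \<le> h l" "h l \<le> b"
proof -
  have "1-lipschitz_on UNIV h"
    using lip by (intro lipschitz_onI) (simp_all add: dist_real_def)
  then have "continuous_on UNIV h" by (rule lipschitz_on_continuous_on)
  then have "closed {y. a \<le> h y \<and> h y \<le> b}"
    by (intro closed_Collect_conj closed_Collect_le continuous_intros) auto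
  then have "compact (K \<inter> {y. a \<le> h y \<and> h y \<le> b})"
    by (rule compact_Int_closed[OF K(1)])
  moreover have "(\<lambda>k. h (x (Suc k)) - h (x k)) \<longlonglongrightarrow> 0"
  proof (rule Lim_null_comparison[OF always_eventually step], intro allI)
    show "norm (h (x (Suc k)) - h (x k)) \<le> norm (x k - x (Suc k))" for k
      using lip[of "x (Suc k)" "x k"] by (simp add: dist_norm norm_minus_commute)
  qed
  then have "\<exists>\<^sub>F k in sequentially. a < h (x k) \<and> h (x k) < b"
    using \<open>a < b\<close> lo hi by (rule frequently_crossing)
  then have "\<exists>\<^sub>F k in sequentially. x k \<in> K \<inter> {y. a \<le> h y \<and> h y \<le> b}"
    by (rule frequently_rev_mp)
      (use K(2) in \<open>auto intro!: eventually_mono[OF eventually_ge_at_top[of 1]]\<close>)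
  ultimately obtain l where "l \<in> K \<inter> {y. a \<le> h y \<and> h y \<le> b}" "l \<in> accumulation_points x"
    by (rule frequently_accumulation_pointI)
  then show thesis using that by blast
qed

text \<open>If convergence failed, the sequence would be infinitely often close to \<open>z\<close>
  and infinitely often away from it. Crossing the annulus in between would create a second
  accumulation point inside the isolating neighbourhood.\<close>

lemma isolated_accumulation_point_imp_tendsto:
  fixes x :: "nat \<Rightarrow> 'a::{real_normed_vector,heine_borel}"
  assumes step: "(\<lambda>k. norm (x k - x (Suc k))) \<longlonglongrightarrow> 0"
    and z: "z isolated_in accumulation_points x"
  shows "x \<longlonglongrightarrow> z"
proof (rule ccontr)
  assume "\<not> x \<longlonglongrightarrow> z"
  then obtain e where "e > 0" "\<not> (\<forall>\<^sub>F k in sequentially. dist (x k) z < e)"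
    unfolding tendsto_iff by blast
  then have e: "e > 0" "\<exists>\<^sub>F k in sequentially. e \<le> dist (x k) z"
    by (simp_all add: frequently_def not_le)
  obtain T where T: "open T" "T \<inter> accumulation_points x = {z}"
    using z unfolding isolated_in_def by blast
  then have "z \<in> T" by blast
  with T(1) obtain d where d: "d > 0" "ball z d \<subseteq> T" using open_contains_ball by blast
  \<comment> \<open>With \<open>b \<le> e\<close> the distant visits lie outside the annulus from
    \<open>b / 2\<close> to \<open>b\<close>; with \<open>b < d\<close> the annulus lies inside the
    isolating ball.\<close>
  define b where "b = min e (d / 2)"
  have b: "b > 0" "b \<le> e" "b < d" using e d by (auto simp: b_def)
  have zacc: "z \<in> accumulation_points x" using T by auto
  have "\<exists>\<^sub>F k in sequentially. x k \<in> ball z (b / 2)"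
    using accumulation_point_frequently[OF zacc, of "ball z (b/2)"] b by simp
  then have lo: "\<exists>\<^sub>F k in sequentially. dist (x k) z \<le> b / 2"
    by (rule frequently_elim1) (simp add: dist_commute)
  have hi: "\<exists>\<^sub>F k in sequentially. b \<le> dist (x k) z"
    using e(2) by (rule frequently_elim1) (use b in simp)
  obtain l where l: "l \<in> accumulation_points x" "b / 2 \<le> dist l z" "dist l z \<le> b"
    by (rule lipschitz_crossing_accumulation_point[where h = "\<lambda>y. dist y z",
        OF step _ _ lo hi compact_cball[of z b]])
      (use b in \<open>auto simp: dist_commute intro: abs_dist_diff_le[of _ z, unfolded dist_commute[of z]]\<close>)
  then have "l \<in> T" using b d by (auto simp: dist_commute)
  with l(1) T(2) have "l = z" by blast
  with l(2) b show False by simp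
qed

text \<open>Two disjoint closed pieces, one of them compact, have a positive distance
  \<open>d\<close>. The sequence comes close to both infinitely often, so its distance to
  \<open>S\<close> crosses the range from \<open>d / 3\<close> to \<open>d / 2\<close>, and an
  accumulation point found there belongs to neither piece.\<close>

lemma connected_accumulation_points:
  fixes x :: "nat \<Rightarrow> 'a::{real_normed_vector,heine_borel}"
  assumes step: "(\<lambda>k. norm (x k - x (Suc k))) \<longlonglongrightarrow> 0"
    and K: "compact K" "\<And>k. k \<ge> 1 \<Longrightarrow> x k \<in> K" "accumulation_points x \<subseteq> K"
  shows "connected (accumulation_points x)"
  unfolding connected_closed_set[OF closed_accumulation_points]
proof clarify
  fix S T assume ST: "closed S" "closed T" "S \<noteq> {}" "T \<noteq> {}" "S \<union> T = accumulation_points x"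
    "S \<inter> T = {}"
  have "S = K \<inter> S" using ST K(3) by blast
  then have "compact S" using compact_Int_closed[OF K(1) ST(1)] by simp
  then obtain d where d: "d > 0" "\<And>y z. y \<in> S \<Longrightarrow> z \<in> T \<Longrightarrow> d \<le> dist y z"
    using separate_compact_closed[of S T] ST by metis
  have far: "d \<le> infdist z S" if "z \<in> T" for z
    using that d(2) ST(3) by (auto simp: infdist_def dist_commute intro!: cINF_greatest)
  obtain y z where y: "y \<in> S" and z: "z \<in> T" using ST by blast
  have "\<exists>\<^sub>F k in sequentially. x k \<in> ball y (d / 3)"
    using accumulation_point_frequently[of y x "ball y (d/3)"] ST y d by auto
  then have lo: "\<exists>\<^sub>F k in sequentially. infdist (x k) S \<le> d / 3"
    by (rule frequently_elim1) (rule infdist_le2[OF y], simp add: dist_commute)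
  have "\<exists>\<^sub>F k in sequentially. x k \<in> ball z (d / 3)"
    using accumulation_point_frequently[of z x "ball z (d/3)"] ST z d by auto
  \<comment> \<open>Within \<open>d / 3\<close> of \<open>z\<close> the distance to \<open>S\<close>
    is still at least \<open>2 * d / 3\<close>.\<close>
  then have hi: "\<exists>\<^sub>F k in sequentially. d / 2 \<le> infdist (x k) S"
  proof (rule frequently_elim1)
    fix k assume "x k \<in> ball z (d / 3)"
    then show "d / 2 \<le> infdist (x k) S"
      using infdist_triangle[of z S "x k"] far[OF z] d(1) by simp
  qed
  obtain l where l: "l \<in> accumulation_points x" "d / 3 \<le> infdist l S" "infdist l S \<le> d / 2"
    by (rule lipschitz_crossing_accumulation_point[where h = "\<lambda>y. infdist y S",
        OF step infdist_triangle_abs _ lo hi K(1)]) (use d K(2) in auto)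
  have "l \<notin> S" using l(2) d(1) by auto
  moreover have "l \<notin> T" using l(3) far[of l] d(1) by auto
  ultimately show False using l(1) ST by blast
qed

lemma accumulation_points_bounded:
  fixes x :: "nat \<Rightarrow> 'a::{real_normed_vector,heine_borel}"
  assumes step: "(\<lambda>k. norm (x k - x (Suc k))) \<longlonglongrightarrow> 0" and bd: "bounded (x ` {1..})"
  shows "accumulation_points x \<noteq> {} \<and> compact (accumulation_points x) \<and>
    connected (accumulation_points x)"
proof -
  \<comment> \<open>The index starts at 1 because boundedness is assumed only from there; a single
    extra term does not affect accumulation points.\<close>
  define K where "K = closure (x ` {1..})"
  have K: "compact K" using bd by (simp add: K_def)
  have xK: "x k \<in> K" if "k \<ge> 1" for k
    unfolding K_def using that by (intro closure_subset[THEN subsetD]) simp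
  have fr: "\<exists>\<^sub>F k in sequentially. x k \<in> K"
    unfolding frequently_sequentially
  proof
    show "\<exists>n\<ge>N. x n \<in> K" for N using xK[of "Suc N"] by (intro exI[of _ "Suc N"]) simp
  qed
  have sub: "accumulation_points x \<subseteq> K"
  proof (rule subsetI, rule ccontr)
    fix l assume l: "l \<in> accumulation_points x" "l \<notin> K"
    have "\<exists>\<^sub>F k in sequentially. x k \<in> - K"
      using l K by (intro accumulation_point_frequently) (auto intro: compact_imp_closed)
    then show False
      using xK unfolding frequently_sequentially by (metis ComplD order_refl)
  qed
  then have "K \<inter> accumulation_points x = accumulation_points x" by blast
  then have "compact (accumulation_points x)"
    using compact_Int_closed[OF K closed_accumulation_points, of x] by simp
  moreover have "accumulation_points x \<noteq> {}"
    by (rule frequently_accumulation_pointI[OF K fr]) auto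
  moreover have "connected (accumulation_points x)"
    by (rule connected_accumulation_points[OF step K xK sub])
  ultimately show ?thesis by simp
qed

section \<open>Descent with summable errors\<close>

text \<open>Telescoping bounds the partial sums of \<open>s\<close> by
  \<open>v 0 + suminf e - m\<close>, so \<open>s\<close> is summable.\<close>

lemma perturbed_descent_steps_tendsto_0:
  fixes v s e :: "nat \<Rightarrow> real"
  assumes desc: "\<And>k. v (Suc k) + s k \<le> v k + e k" and low: "\<And>k. m \<le> v k"
    and s: "\<And>k. 0 \<le> s k" and e: "\<And>k. 0 \<le> e k" "summable e"
  shows "s \<longlonglongrightarrow> 0"
proof -
  have tele: "v n + (\<Sum>k<n. s k) \<le> v 0 + (\<Sum>k<n. e k)" for n
  proof (induction n)
    case (Suc n)
    then show ?case using desc[of n] by simp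
  qed simp
  have "(\<Sum>k<n. s k) \<le> v 0 + suminf e - m" for n
  proof -
    have "(\<Sum>k<n. e k) \<le> suminf e"
      using e by (intro sum_le_suminf) auto
    then show ?thesis using tele[of n] low[of n] by linarith
  qed
  then have "summable s" using s by (intro summableI_nonneg_bounded) auto
  then show ?thesis by (rule summable_LIMSEQ_zero)
qed

text \<open>Monotonicity gives a limit \<open>l\<close>. If \<open>l\<close> were positive,
  \<open>r (Suc k) - c * r k\<close> would tend to the positive number \<open>l - c * l\<close>,
  leaving room for only finitely many contractions.\<close>

lemma decreasing_with_contractions_tendsto_0:
  fixes r :: "nat \<Rightarrow> real"
  assumes c: "c < 1" and dec: "decseq r" "\<And>k. 0 \<le> r k"
    and fr: "\<exists>\<^sub>F k in sequentially. r (Suc k) \<le> c * r k"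
  shows "r \<longlonglongrightarrow> 0"
proof -
  obtain l where l: "r \<longlonglongrightarrow> l" using decseq_convergent[OF dec(1)] dec(2) by metis
  have "l \<ge> 0" using l dec(2) by (intro LIMSEQ_le_const) auto
  moreover have "\<not> l > 0"
  proof
    assume "l > 0"
    with c have "c * l < l" by simp
    moreover have "(\<lambda>k. r (Suc k) - c * r k) \<longlonglongrightarrow> l - c * l"
      by (intro tendsto_intros l LIMSEQ_Suc)
    ultimately have "\<forall>\<^sub>F k in sequentially. 0 < r (Suc k) - c * r k"
      by (intro order_tendstoD(1)) auto
    with fr show False
      unfolding frequently_def by (auto elim!: notE eventually_mono)
  qed
  ultimately have "l = 0" by simp
  with l show ?thesis by simp
qed

text \<open>The same estimate serves both error rules: a summable error is carried along as \<open>e\<close>, while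
  \<open>C \<epsilon>\<^sub>k\<^sup>2 \<le> C1 / 4 * \<epsilon>\<^sub>k\<^sup>2\<close> is absorbed (with \<open>e = 0\<close>) because a non-null step has length at
  least \<open>lam * \<epsilon>\<^sub>k\<close>.\<close>

lemma proximal_step_decrease:
  fixes lam L \<rho> n d e \<epsilon> :: real
  assumes lam: "lam > 0" "lam * (L + \<rho>) < 1" and "\<rho> \<ge> 0"
    and d: "d \<le> e \<or> (d \<le> lam * (1 - lam * (L + \<rho>)) / 4 * \<epsilon>\<^sup>2 \<and> 0 \<le> e)"
    and n: "0 \<le> \<epsilon>" "lam * \<epsilon> \<le> n"
  shows "d + (1 - lam * (L + \<rho>)) / (4 * lam) * n\<^sup>2 \<le> e + (1 / lam - L) / 2 * n\<^sup>2"
proof -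
  \<comment> \<open>The available coefficient \<open>(1 / lam - L) / 2\<close> is at least
    \<open>2 * a\<close>: one copy of \<open>a * n\<^sup>2\<close> is kept, the other absorbs the
    error, whose bound equals \<open>a * (lam * \<epsilon>)\<^sup>2\<close>.\<close>
  define a where "a = (1 - lam * (L + \<rho>)) / (4 * lam)"
  have a: "a > 0" using lam by (simp add: a_def)
  have "2 * a = (1 / lam - L) / 2 - \<rho> / 2" using lam by (simp add: a_def field_simps)
  with \<open>\<rho> \<ge> 0\<close> have "2 * a \<le> (1 / lam - L) / 2" by linarith
  then have "2 * a * n\<^sup>2 \<le> (1 / lam - L) / 2 * n\<^sup>2" by (intro mult_right_mono) auto
  moreover have "d \<le> e + a * n\<^sup>2"
    using d
  proof
    assume "d \<le> lam * (1 - lam * (L + \<rho>)) / 4 * \<epsilon>\<^sup>2 \<and> 0 \<le> e"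
    moreover have "lam * (1 - lam * (L + \<rho>)) / 4 * \<epsilon>\<^sup>2 = a * (lam * \<epsilon>)\<^sup>2"
      using lam by (simp add: a_def field_simps power2_eq_square)
    moreover have "a * (lam * \<epsilon>)\<^sup>2 \<le> a * n\<^sup>2"
      using a n lam by (intro mult_left_mono power_mono) auto
    ultimately show ?thesis by linarith
  qed (use a in \<open>simp add: add_increasing2\<close>)
  ultimately show ?thesis unfolding a_def[symmetric] by linarith
qed

text \<open>Finiteness at \<open>K\<close> propagates along the descent, and \<open>m\<close>
  excludes the value minus infinity. From \<open>K\<close> on the objective is thus real and the
  telescoping lemma applies to the shifted sequences.\<close>

lemma perturbed_descent_increments_tendsto_0:
  fixes x :: "nat \<Rightarrow> 'a::real_normed_vector" and \<phi> :: "'a \<Rightarrow> ereal"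
  assumes a: "a > 0"
    and desc: "\<And>k. k \<ge> K \<Longrightarrow> \<phi> (x (Suc k)) + ereal (a * (norm (x (Suc k) - x k))\<^sup>2)
                 \<le> \<phi> (x k) + ereal (e k)"
    and low: "\<And>k. k \<ge> K \<Longrightarrow> ereal m \<le> \<phi> (x k)" and fin: "\<phi> (x K) \<noteq> \<infinity>"
    and e: "\<And>k. k \<ge> K \<Longrightarrow> 0 \<le> e k" "summable e"
  shows "(\<lambda>k. norm (x k - x (Suc k))) \<longlonglongrightarrow> 0"
proof -
  have "\<bar>\<phi> (x k)\<bar> \<noteq> \<infinity>" if "k \<ge> K" for k
    using that
  proof (induction k rule: dec_induct)
    case base
    show ?case using fin low[of K] by (cases "\<phi> (x K)") auto
  next
    case (step k)
    then show ?case
      using desc[of k] low[of "Suc k"] by (cases "\<phi> (x k)"; cases "\<phi> (x (Suc k))") auto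
  qed
  then have "\<exists>v. \<phi> (x (k + K)) = ereal v" for k by (metis abs_neq_infinity_cases le_add2)
  then obtain v where v: "\<And>k. \<phi> (x (k + K)) = ereal (v k)" by metis
  define s where "s k = a * (norm (x (Suc (k + K)) - x (k + K)))\<^sup>2" for k
  have "s \<longlonglongrightarrow> 0"
  proof (rule perturbed_descent_steps_tendsto_0)
    show "v (Suc k) + s k \<le> v k + e (k + K)" for k
      using desc[of "k + K"] v[of k] v[of "Suc k"] by (simp add: s_def)
    show "m \<le> v k" for k using low[of "k + K"] v[of k] by simp
    show "summable (\<lambda>k. e (k + K))" using e(2) by (simp add: summable_iff_shift)
  qed (use a e in \<open>auto simp: s_def\<close>)
  then have "(\<lambda>k. sqrt (s k / a)) \<longlonglongrightarrow> sqrt (0 / a)"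
    using a by (intro tendsto_intros) auto
  then have "(\<lambda>k. norm (x (k + K) - x (Suc (k + K)))) \<longlonglongrightarrow> 0"
    using a by (simp add: s_def norm_minus_commute)
  then show ?thesis by (rule LIMSEQ_offset)
qed

section \<open>Stationarity of limits of proximal points\<close>

text \<open>The limiting subdifferential demands convergence of function values along
  \<open>q\<close>, not only of points and subgradients. Semicontinuity bounds
  \<open>g (q k)\<close> from below, and testing the minimality of \<open>q k\<close> at a fixed
  point bounds it from above.\<close>

lemma stationary_point_prox_limit:
  fixes f :: "'a::euclidean_space \<Rightarrow> real" and g :: "'a \<Rightarrow> ereal"
  assumes C1: "C1_with_gradient f df" and pr: "proper_fun g" and lsc: "lsc_fun g"
    and lam: "lam > 0"
    and min: "\<And>k w. prox_objective g lam (forward_step lam df (y k)) (q k)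
                  \<le> prox_objective g lam (forward_step lam df (y k)) w"
    and y: "y \<longlonglongrightarrow> z" and yq: "(\<lambda>k. y k - q k) \<longlonglongrightarrow> 0"
  shows "stationary_point (\<lambda>y. ereal (f y) + g y) z"
proof -
  have q: "q \<longlonglongrightarrow> z" using tendsto_diff[OF y yq] by simp
  have df: "continuous_on UNIV df" "\<And>u. GDERIV f u :> df u"
    using C1 by (auto simp: C1_with_gradient_def)
  have dfy: "(\<lambda>k. df (y k)) \<longlonglongrightarrow> df z" and dfq: "(\<lambda>k. df (q k)) \<longlonglongrightarrow> df z"
    using y q by (auto intro: continuous_on_tendsto_compose[OF df(1)])
  define F where "F k = forward_step lam df (y k)" for k
  have F: "F \<longlonglongrightarrow> forward_step lam df z"
    unfolding F_def forward_step_def by (intro tendsto_intros y dfy)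
  define c where "c w k = 1 / (2 * lam) * (norm (w - F k))\<^sup>2 - 1 / (2 * lam) * (norm (q k - F k))\<^sup>2"
    for w k
  have c_lim: "c w \<longlonglongrightarrow> 1 / (2 * lam) * (norm (w - forward_step lam df z))\<^sup>2
        - 1 / (2 * lam) * (norm (z - forward_step lam df z))\<^sup>2" for w
    unfolding c_def by (intro tendsto_intros F q)
  have upper: "g (q k) \<le> ereal (\<beta> + c w k)" if "g w = ereal \<beta>" for w \<beta> k
    using min[of k w] that
    by (cases "g (q k)") (auto simp: F_def c_def prox_objective_def)
  have gMInf: "g u \<noteq> -\<infinity>" for u using pr by (simp add: proper_fun_def)
  \<comment> \<open>A first test point, anywhere in the domain, shows that \<open>g z\<close> is
    finite. Only then can \<open>z\<close> itself be the test point, for which \<open>c z\<close>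
    tends to 0 and the upper bound becomes sharp.\<close>
  obtain w where "g w \<noteq> \<infinity>" using pr by (auto simp: proper_fun_def)
  with gMInf[of w] obtain \<beta> where "g w = ereal \<beta>" by (cases "g w") auto
  from lsc_fun_tendsto_le[OF lsc q upper[OF this] tendsto_add[OF tendsto_const c_lim]]
  have "g z \<noteq> \<infinity>" by auto
  with gMInf[of z] obtain \<gamma> where \<gamma>: "g z = ereal \<gamma>" by (cases "g z") auto
  have "(\<lambda>k. g (q k)) \<longlonglongrightarrow> g z"
  proof (rule order_tendstoI)
    show "\<forall>\<^sub>F k in sequentially. a < g (q k)" if "a < g z" for a
      by (rule lsc_fun_eventually_less[OF lsc q that])
    fix a assume "g z < a"
    have "(\<lambda>k. ereal (\<gamma> + c z k)) \<longlonglongrightarrow> ereal (\<gamma> + 0)"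
      using c_lim[of z] by (intro tendsto_intros) simp
    with \<open>g z < a\<close> \<gamma> have "\<forall>\<^sub>F k in sequentially. ereal (\<gamma> + c z k) < a"
      by (intro order_tendstoD) auto
    then show "\<forall>\<^sub>F k in sequentially. g (q k) < a"
      by eventually_elim (rule le_less_trans[OF upper[OF \<gamma>]])
  qed
  moreover have "isCont f z"
    using df(2)[of z] unfolding gderiv_def by (rule has_derivative_continuous)
  then have "(\<lambda>k. ereal (f (q k))) \<longlonglongrightarrow> ereal (f z)"
    using q by (intro tendsto_intros isCont_tendsto_compose[of _ f])
  ultimately have phi: "(\<lambda>k. ereal (f (q k)) + g (q k)) \<longlonglongrightarrow> ereal (f z) + g z"
    using \<gamma> by (intro tendsto_add_ereal) auto
  \<comment> \<open>These are the subgradients at \<open>q k\<close>; the two gradients have the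
    same limit and cancel.\<close>
  define v where "v k = df (q k) + ((1 / lam) *\<^sub>R (y k - q k) - df (y k))" for k
  have "v k \<in> regular_subdifferential (\<lambda>y. ereal (f y) + g y) (q k)" for k
    unfolding v_def by (rule prox_objective_minimizer_subgradient[OF lam pr min df(2)])
  moreover have "v \<longlonglongrightarrow> df z + ((1 / lam) *\<^sub>R 0 - df z)"
    unfolding v_def by (intro tendsto_intros dfy dfq yq)
  then have "v \<longlonglongrightarrow> 0" by simp
  ultimately show ?thesis
    using q phi \<gamma> unfolding stationary_point_def limiting_subdifferential_def by auto
qed

section \<open>Convergence of the inexact proximal gradient method\<close>

theorem theorem3p17:
  fixes f :: "real ^ 'n \<Rightarrow> real" and df :: "real ^ 'n \<Rightarrow> real ^ 'n"
    and g \<phi> :: "real ^ 'n \<Rightarrow> ereal"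
    and L \<rho> lam \<mu> \<theta> C C1 C2 :: real
    and x p :: "nat \<Rightarrow> real ^ 'n" and \<epsilon> r err :: "nat \<Rightarrow> real"
  assumes "L > 0" and "\<rho> \<ge> 0"
    and "C1_with_gradient f df" and "descent_condition L f df"
    and "proper_fun g" and "lsc_fun g" and "weakly_convex \<rho> g"
    and "\<phi> = (\<lambda>y. ereal (f y) + g y)"
    and "0 < lam" and "lam < inverse (L + \<rho>)"
    and "0 < \<mu>" and "\<mu> < 1" and "0 < \<theta>" and "\<theta> < 1" and "\<theta> \<le> \<mu>"
    and "0 < \<epsilon> 1" and "0 < r 1" and "\<epsilon> 1 \<le> r 1"
    and "\<And>k. k \<ge> 1 \<Longrightarrow> err k \<ge> 0"
    and "inexact_prox_grad df g \<rho> lam \<mu> \<theta> err x p \<epsilon> r"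
    and "C1 = lam * (1 - lam * (L + \<rho>))"
    and "C2 = 2 * (sqrt (2 / (inverse lam - \<rho>)) + sqrt (2 * lam))"
    and "C = min (C1\<^sup>2 / (4 * C2\<^sup>2)) (C1 / 4)"
    and "summable (\<lambda>k. err (Suc k)) \<or> (\<forall>k\<ge>1. err k = C * (\<epsilon> k)\<^sup>2)"
    and "(INF k\<in>{1..}. \<phi> (x k)) > -\<infinity>"
  shows "((\<forall>k\<ge>1. 0 < \<epsilon> k \<and> \<epsilon> (Suc k) \<le> \<epsilon> k) \<and> \<epsilon> \<longlonglongrightarrow> 0 \<and>
          (\<forall>k\<ge>1. 0 < r k \<and> r (Suc k) \<le> r k) \<and> r \<longlonglongrightarrow> 0) \<and>
         ((\<forall>z\<in>accumulation_points x. stationary_point \<phi> z) \<and>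
          (\<lambda>k. norm (x k - x (Suc k))) \<longlonglongrightarrow> 0) \<and>
         (bounded (x ` {1..}) \<longrightarrow>
          accumulation_points x \<noteq> {} \<and> compact (accumulation_points x) \<and>
          connected (accumulation_points x)) \<and>
         (\<forall>z. z isolated_in accumulation_points x \<longrightarrow> x \<longlonglongrightarrow> z)"
proof -
  note prox = \<open>inexact_prox_grad df g \<rho> lam \<mu> \<theta> err x p \<epsilon> r\<close>
  note \<phi> = \<open>\<phi> = (\<lambda>y. ereal (f y) + g y)\<close>
  have lam: "lam > 0" "lam * (L + \<rho>) < 1" "\<rho> < 1 / lam"
  proof -
    show "lam > 0" by fact
    then show *: "lam * (L + \<rho>) < 1"
      using \<open>lam < inverse (L + \<rho>)\<close> \<open>L > 0\<close> \<open>\<rho> \<ge> 0\<close> by (simp add: field_simps)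
    have "0 < lam * L" using \<open>lam > 0\<close> \<open>L > 0\<close> by simp
    with * have "lam * \<rho> < 1" by (simp add: distrib_left)
    then show "\<rho> < 1 / lam" using \<open>lam > 0\<close> by (simp add: field_simps)
  qed
  define null where "null k \<longleftrightarrow> norm ((1 / lam) *\<^sub>R (x k - p k)) \<le> r k + \<epsilon> k" for k
  define d where "d k = min (lam * (1 - lam * \<rho>) * (\<epsilon> k)\<^sup>2 / 2) (err k)" for k
  define \<Phi> where "\<Phi> k = prox_objective g lam (forward_step lam df (x k))" for k
  have inexact: "\<Phi> k (p k) \<le> (INF y. \<Phi> k y) + ereal (d k)" if "k \<ge> 1" for k
    using prox that unfolding inexact_prox_grad_def \<Phi>_def d_def by blast
  have nullD: "r (Suc k) = \<mu> * r k" "\<epsilon> (Suc k) = \<theta> * \<epsilon> k" "x (Suc k) = x k" if "k \<ge> 1" "null k" for k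
    using prox that unfolding inexact_prox_grad_def null_def by metis+
  have nonnullD: "r (Suc k) = r k" "\<epsilon> (Suc k) = \<epsilon> k" "x (Suc k) = p k" if "k \<ge> 1" "\<not> null k" for k
    using prox that unfolding inexact_prox_grad_def null_def by metis+
  have pos: "0 < \<epsilon> k \<and> 0 < r k" if "k \<ge> 1" for k
    using that
  proof (induction k rule: dec_induct)
    case base
    show ?case using \<open>0 < \<epsilon> 1\<close> \<open>0 < r 1\<close> by simp
  next
    case (step k)
    then show ?case
      using nullD[of k] nonnullD[of k] \<open>0 < \<mu>\<close> \<open>0 < \<theta>\<close> by (cases "null k") auto
  qed
  have mono: "\<epsilon> (Suc k) \<le> \<epsilon> k \<and> r (Suc k) \<le> r k" if "k \<ge> 1" for k
    using that nullD[of k] nonnullD[of k] \<open>\<mu> < 1\<close> \<open>\<theta> < 1\<close> pos[of k]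
    by (cases "null k") (auto simp: mult_le_cancel_right1)
  have null_iff: "null k \<longleftrightarrow> norm (p k - x k) \<le> lam * (r k + \<epsilon> k)" for k
    using lam(1) unfolding null_def norm_scaleR
    by (simp add: norm_minus_commute pos_divide_le_eq mult.commute)
  have long: "lam * (r k + \<epsilon> k) \<le> norm (p k - x k)" if "\<not> null k" for k
    using that unfolding null_iff by simp

  \<comment> \<open>One summable sequence for both error rules: the errors themselves if they are
    summable, otherwise 0. The value at 0 is set to 0 since the sign of \<open>err 0\<close> is
    unknown.\<close>
  define e where "e k = (if summable (\<lambda>k. err (Suc k)) \<and> k \<ge> 1 then err k else 0)" for k
  have e: "0 \<le> e k" "summable e" for k
  proof -
    show "0 \<le> e k" using \<open>\<And>k. k \<ge> 1 \<Longrightarrow> err k \<ge> 0\<close> by (simp add: e_def)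
    have "summable (\<lambda>k. e (Suc k))" by (cases "summable (\<lambda>k. err (Suc k))") (simp_all add: e_def)
    then show "summable e" by (simp only: summable_Suc_iff)
  qed
  define a where "a = (1 - lam * (L + \<rho>)) / (4 * lam)"
  have a: "a > 0" using lam by (simp add: a_def)
  have desc: "\<phi> (x (Suc k)) + ereal (a * (norm (x (Suc k) - x k))\<^sup>2) \<le> \<phi> (x k) + ereal (e k)"
    if k: "k \<ge> 1" for k
  proof (cases "null k")
    case True
    then show ?thesis using nullD[OF k] e(1) by (simp add: add_increasing2)
  next
    case False
    define n where "n = norm (p k - x k)"
    \<comment> \<open>This brings the second error rule into the form that
      \<open>proximal_step_decrease\<close> absorbs.\<close>
    have "C * (\<epsilon> k)\<^sup>2 \<le> C1 / 4 * (\<epsilon> k)\<^sup>2"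
      using \<open>C = _\<close> by (intro mult_right_mono) auto
    then have "err k \<le> e k \<or> (err k \<le> lam * (1 - lam * (L + \<rho>)) / 4 * (\<epsilon> k)\<^sup>2 \<and> 0 \<le> e k)"
      using \<open>summable (\<lambda>k. err (Suc k)) \<or> _\<close> k e(1)[of k] \<open>C1 = _\<close>
      by (auto simp: e_def)
    then have "d k \<le> e k \<or> (d k \<le> lam * (1 - lam * (L + \<rho>)) / 4 * (\<epsilon> k)\<^sup>2 \<and> 0 \<le> e k)"
      by (auto simp: d_def)
    moreover have "lam * \<epsilon> k \<le> n"
      using long[OF False] pos[OF k] lam(1) mult_pos_pos[of lam "r k"]
      unfolding n_def distrib_left by linarith
    ultimately have key: "d k + a * n\<^sup>2 \<le> e k + (1 / lam - L) / 2 * n\<^sup>2"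
      using proximal_step_decrease[OF lam(1,2) \<open>\<rho> \<ge> 0\<close>] pos[OF k] unfolding a_def by simp
    have "\<Phi> k (p k) \<le> \<Phi> k (x k) + ereal (d k)"
      by (rule order_trans[OF inexact[OF k] add_right_mono]) (rule INF_lower, simp)
    then have "ereal (f (p k)) + g (p k) + ereal ((1 / lam - L) / 2 * n\<^sup>2)
        \<le> ereal (f (x k)) + g (x k) + ereal (d k)"
      unfolding \<Phi>_def n_def
      by (rule inexact_prox_grad_descent[OF \<open>descent_condition L f df\<close> lam(1)])
    with key show ?thesis
      unfolding \<phi> nonnullD(3)[OF k False] n_def[symmetric]
      by (cases "g (p k)"; cases "g (x k)") auto
  qed
  obtain m where m: "ereal m < (INF k\<in>{1..}. \<phi> (x k))"
    using ereal_dense2[OF \<open>(INF k\<in>{1..}. \<phi> (x k)) > -\<infinity>\<close>] by auto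
  have low: "ereal m \<le> \<phi> (x k)" if "k \<ge> 1" for k
    using m INF_lower[of k "{1..}" "\<lambda>k. \<phi> (x k)"] that by simp
  have step: "(\<lambda>k. norm (x k - x (Suc k))) \<longlonglongrightarrow> 0"
  proof (cases "\<exists>K\<ge>1. \<phi> (x K) \<noteq> \<infinity>")
    case True
    then obtain K where K: "K \<ge> 1" "\<phi> (x K) \<noteq> \<infinity>" by blast
    show ?thesis
      by (rule perturbed_descent_increments_tendsto_0[where \<phi> = \<phi> and K = K and e = e and m = m, OF a])
        (use K desc low e in auto)
  next
    \<comment> \<open>The objective may be infinite at every iterate. A non-null step would move to
      \<open>p k\<close>, where the objective is finite because the infimum of
      \<open>\<Phi> k\<close> is below infinity; hence all steps are null and the sequence is
      constant.\<close>
    case False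
    have "null k" if k: "k \<ge> 1" for k
    proof (rule ccontr)
      assume nn: "\<not> null k"
      obtain q where q: "\<And>y. \<Phi> k q \<le> \<Phi> k y"
        using prox_objective_minimizer[OF \<open>weakly_convex \<rho> g\<close> \<open>proper_fun g\<close> \<open>lsc_fun g\<close> lam(3)
          inexact[OF k, unfolded \<Phi>_def]] unfolding \<Phi>_def by blast
      obtain w where "g w \<noteq> \<infinity>" using \<open>proper_fun g\<close> by (auto simp: proper_fun_def)
      then have "(INF y. \<Phi> k y) \<noteq> \<infinity>"
        using INF_lower[of w UNIV "\<Phi> k"] by (auto simp: \<Phi>_def prox_objective_def)
      then have "\<Phi> k (p k) \<noteq> \<infinity>" using inexact[OF k] by (cases "INF y. \<Phi> k y") auto
      then have "\<phi> (p k) \<noteq> \<infinity>" by (auto simp: \<Phi>_def prox_objective_def \<phi>)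
      then show False using False nonnullD(3)[OF k nn] k by (metis le_SucI)
    qed
    then have "\<forall>\<^sub>F k in sequentially. norm (x k - x (Suc k)) = 0"
      using nullD(3) by (auto intro!: eventually_mono[OF eventually_ge_at_top[of 1]])
    then show ?thesis by (rule tendsto_eventually)
  qed

  have often: "\<exists>\<^sub>F k in sequentially. null k"
  proof (rule ccontr)
    assume "\<not> ?thesis"
    then obtain N where N: "\<And>k. k \<ge> N \<Longrightarrow> \<not> null k"
      by (auto simp: not_frequently eventually_sequentially)
    define M where "M = max 1 N"
    \<comment> \<open>Without null steps \<open>r\<close> is frozen, so every step is at least
      \<open>lam * r M\<close> long, against \<open>step\<close>.\<close>
    have const: "r k = r M" if "k \<ge> M" for k
      using that
    proof (induction k rule: dec_induct)
      case (step k)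
      then show ?case using nonnullD(1)[of k] N[of k] by (simp add: M_def)
    qed simp
    have "lam * r M \<le> norm (x k - x (Suc k))" if k: "k \<ge> M" for k
    proof -
      have "k \<ge> 1" "\<not> null k" using k N by (auto simp: M_def)
      then have "lam * (r k + \<epsilon> k) \<le> norm (x k - x (Suc k))" "0 < lam * \<epsilon> k"
        using long[of k] nonnullD(3)[of k] pos[of k] lam(1) by (simp_all add: norm_minus_commute)
      then show ?thesis using const[OF k] by (simp add: distrib_left)
    qed
    then have "lam * r M \<le> 0" by (intro LIMSEQ_le_const[OF step]) blast
    moreover have "0 < lam * r M" using lam(1) pos[of M] by (simp add: M_def)
    ultimately show False by simp
  qed
  \<comment> \<open>Stated for a generic \<open>u\<close> to serve both \<open>\<epsilon>\<close>
    and \<open>r\<close>; it works with the shifted sequence because nothing is known at index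
    0.\<close>
  have to_0: "u \<longlonglongrightarrow> 0"
    if "c < 1" "\<And>k. k \<ge> 1 \<Longrightarrow> 0 \<le> u k \<and> u (Suc k) \<le> u k" "\<And>k. k \<ge> 1 \<Longrightarrow> null k \<Longrightarrow> u (Suc k) = c * u k"
    for u :: "nat \<Rightarrow> real" and c
  proof -
    have "(\<lambda>k. u (Suc k)) \<longlonglongrightarrow> 0"
    proof (rule decreasing_with_contractions_tendsto_0[OF \<open>c < 1\<close>])
      show "decseq (\<lambda>k. u (Suc k))" using that(2) by (intro decseq_SucI) simp
      show "\<exists>\<^sub>F k in sequentially. u (Suc (Suc k)) \<le> c * u (Suc k)"
        unfolding frequently_sequentially
      proof
        fix N
        obtain n where "n \<ge> Suc N" "null n" using often unfolding frequently_sequentially by blast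
        then show "\<exists>k\<ge>N. u (Suc (Suc k)) \<le> c * u (Suc k)"
          using that(3)[of n] by (intro exI[of _ "n - 1"]) auto
      qed
    qed (use that(2) in simp)
    then show ?thesis by (rule LIMSEQ_imp_Suc)
  qed
  have \<epsilon>0: "\<epsilon> \<longlonglongrightarrow> 0"
    by (rule to_0[OF \<open>\<theta> < 1\<close>]) (use pos mono nullD in \<open>auto simp: less_imp_le\<close>)
  have r0: "r \<longlonglongrightarrow> 0"
    by (rule to_0[OF \<open>\<mu> < 1\<close>]) (use pos mono nullD in \<open>auto simp: less_imp_le\<close>)

  \<comment> \<open>The first summand of the bound covers null steps, the second covers the others,
    where \<open>p k\<close> is the next iterate.\<close>
  have xp: "(\<lambda>k. x k - p k) \<longlonglongrightarrow> 0"
  proof (rule Lim_null_comparison)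
    show "\<forall>\<^sub>F k in sequentially. norm (x k - p k) \<le> lam * (r k + \<epsilon> k) + norm (x k - x (Suc k))"
      using eventually_ge_at_top[of 1]
    proof eventually_elim
      case (elim k)
      show ?case
      proof (cases "null k")
        case True
        then have "norm (x k - p k) \<le> lam * (r k + \<epsilon> k)"
          by (simp add: null_iff norm_minus_commute)
        then show ?thesis by (simp add: add_increasing2)
      next
        case False
        then show ?thesis using nonnullD(3)[OF elim] pos[OF elim] lam(1) by simp
      qed
    qed
    have "(\<lambda>k. lam * (r k + \<epsilon> k) + norm (x k - x (Suc k))) \<longlonglongrightarrow> lam * (0 + 0) + 0"
      by (intro tendsto_intros r0 \<epsilon>0 step)
    then show "(\<lambda>k. lam * (r k + \<epsilon> k) + norm (x k - x (Suc k))) \<longlonglongrightarrow> 0" by simp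
  qed
  have "\<exists>q. (\<forall>y. \<Phi> k q \<le> \<Phi> k y) \<and> norm (p k - q) \<le> 2 * lam * \<epsilon> k" if k: "k \<ge> 1" for k
  proof -
    obtain q where q: "\<And>y. \<Phi> k q \<le> \<Phi> k y" "(1 / lam - \<rho>) / 4 * (norm (p k - q))\<^sup>2 \<le> d k"
      using prox_objective_minimizer[OF \<open>weakly_convex \<rho> g\<close> \<open>proper_fun g\<close> \<open>lsc_fun g\<close> lam(3)
          inexact[OF k, unfolded \<Phi>_def]] unfolding \<Phi>_def by blast
    have "d k \<le> lam * (1 - lam * \<rho>) * (\<epsilon> k)\<^sup>2 / 2" by (simp add: d_def)
    \<comment> \<open>The first entry of the minimum in the inexactness rule is matched with the
      strong convexity factor; cancelling that factor gives distance at most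
      \<open>sqrt 2 * lam * \<epsilon> k\<close>, rounded up to
      \<open>2 * lam * \<epsilon> k\<close>.\<close>
    also have "\<dots> = (1 / lam - \<rho>) / 4 * (2 * lam\<^sup>2 * (\<epsilon> k)\<^sup>2)"
      using lam(1) by (simp add: field_simps power2_eq_square)
    finally have "d k \<le> (1 / lam - \<rho>) / 4 * (2 * lam\<^sup>2 * (\<epsilon> k)\<^sup>2)" .
    with q(2) have "(1 / lam - \<rho>) / 4 * (norm (p k - q))\<^sup>2 \<le> (1 / lam - \<rho>) / 4 * (2 * lam\<^sup>2 * (\<epsilon> k)\<^sup>2)"
      by (rule order_trans)
    then have "(norm (p k - q))\<^sup>2 \<le> 2 * lam\<^sup>2 * (\<epsilon> k)\<^sup>2"
      using lam(3) by (subst (asm) mult_le_cancel_left_pos) auto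
    also have "\<dots> \<le> (2 * lam * \<epsilon> k)\<^sup>2" by (simp add: power_mult_distrib)
    finally have "norm (p k - q) \<le> 2 * lam * \<epsilon> k"
      by (rule power2_le_imp_le) (use lam(1) pos[OF k] in simp)
    with q(1) show ?thesis by blast
  qed
  then obtain q where q: "\<And>k y. k \<ge> 1 \<Longrightarrow> \<Phi> k (q k) \<le> \<Phi> k y"
    "\<And>k. k \<ge> 1 \<Longrightarrow> norm (p k - q k) \<le> 2 * lam * \<epsilon> k" by metis
  have "(\<lambda>k. p k - q k) \<longlonglongrightarrow> 0"
  proof (rule Lim_null_comparison)
    show "\<forall>\<^sub>F k in sequentially. norm (p k - q k) \<le> 2 * lam * \<epsilon> k"
      using q(2) by (rule eventually_mono[OF eventually_ge_at_top[of 1]])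
    show "(\<lambda>k. 2 * lam * \<epsilon> k) \<longlonglongrightarrow> 0" using tendsto_mult_right_zero[OF \<epsilon>0] by blast
  qed
  with xp have xq: "(\<lambda>k. x k - q k) \<longlonglongrightarrow> 0"
    using tendsto_add[of "\<lambda>k. x k - p k" 0 sequentially "\<lambda>k. p k - q k" 0] by simp
  have stat: "stationary_point \<phi> z" if z: "z \<in> accumulation_points x" for z
  proof -
    obtain s where s: "strict_mono s" "(x \<circ> s) \<longlonglongrightarrow> z"
      using z by (auto simp: accumulation_points_def)
    \<comment> \<open>Dropping the first term makes all indices at least 1, where \<open>q\<close>
      is known to minimize.\<close>
    define t where "t k = s (Suc k)" for k
    have t: "strict_mono t" using s(1) by (simp add: t_def strict_mono_def)
    have t1: "t k \<ge> 1" for k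
      using strict_monoD[OF s(1), of k "Suc k"] by (simp add: t_def)
    show ?thesis
      unfolding \<phi>
    proof (rule stationary_point_prox_limit[OF \<open>C1_with_gradient f df\<close> \<open>proper_fun g\<close> \<open>lsc_fun g\<close> lam(1)])
      show "prox_objective g lam (forward_step lam df ((x \<circ> t) k)) ((q \<circ> t) k)
          \<le> prox_objective g lam (forward_step lam df ((x \<circ> t) k)) w" for k w
        using q(1)[OF t1[of k], of w] by (simp add: \<Phi>_def)
      show "(x \<circ> t) \<longlonglongrightarrow> z" using LIMSEQ_Suc[OF s(2)] by (simp add: t_def comp_def)
      show "(\<lambda>k. (x \<circ> t) k - (q \<circ> t) k) \<longlonglongrightarrow> 0"
        using LIMSEQ_subseq_LIMSEQ[OF xq t] by (simp add: comp_def)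
    qed
  qed
  show ?thesis
  proof (intro conjI)
    show "\<forall>k\<ge>1. 0 < \<epsilon> k \<and> \<epsilon> (Suc k) \<le> \<epsilon> k" "\<forall>k\<ge>1. 0 < r k \<and> r (Suc k) \<le> r k"
      using pos mono by auto
    show "\<forall>z\<in>accumulation_points x. stationary_point \<phi> z" using stat by auto
    show "bounded (x ` {1..}) \<longrightarrow> accumulation_points x \<noteq> {} \<and>
        compact (accumulation_points x) \<and> connected (accumulation_points x)"
      by (intro impI accumulation_points_bounded[OF step])
    show "\<forall>z. z isolated_in accumulation_points x \<longrightarrow> x \<longlonglongrightarrow> z"
      by (intro allI impI isolated_accumulation_point_imp_tendsto[OF step])
  qed (rule \<epsilon>0 r0 step)+
qed

end
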